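(* Let $A\in\mathbb{R}^{n\times n}$, let $k\ge 2$, and let $p(\lambda)=\lambda^k+c_1\lambda^{k-1}+\cdots+c_{k-1}\lambda+c_k$ be a polynomial with real coefficients such that $p(A)=0$. Let $\mathcal{D}=\{t\in\mathbb{R}:\sigma(I-At)\cap(-\infty,0]=\emptyset\}$. Then, for all $t\in\mathcal{D}$, $$\log(I-At)=f_1(t)I+f_2(t)A+\cdots+f_k(t)A^{k-1},$$ where $f_1,\ldots,f_k$ are differentiable functions in $\mathcal{D}$ given by $$f_1(t)=\int_0^t\frac{c_k s^{k-1}}{1+c_1s+\cdots+c_ks^k}\,ds,$$ $$f_i(t)=\int_0^t\frac{-s^{i-2}-c_1s^{i-1}-\cdots-c_{k-i}s^{k-2}}{1+c_1s+\cdots+c_ks^k}\,ds,\qquad i=2,\ldots,k-1,$$ $$f_k(t)=\int_0^t\frac{-s^{k-2}}{1+c_1s+\cdots+c_ks^k}\,ds.$$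
   Context: $\sigma(X)$ denotes the spectrum (set of complex eigenvalues) of a matrix $X$, and $I$ is the identity matrix. The set $\mathcal{D}$ is an open interval containing $0$. In the formula for $f_i$ with $2\le i\le k-1$ (an empty range when $k=2$), the numerator is $-\sum_{m=0}^{k-i}c_m s^{m+i-2}$ with the convention $c_0=1$. For a real square matrix $B$ with no eigenvalues on the closed negative real axis $(-\infty,0]$, $\log B$ denotes the principal logarithm of $B$: the unique real matrix $X$ with $e^X=B$ all of whose eigenvalues lie in the open strip $\{z\in\mathbb{C}:-\pi<\operatorname{Im} z<\pi\}$.
   Formalization: The formula and differentiability are asserted for those t in D for which 1+c_1s+...+c_ks^k has no zero between 0 and t, since otherwise the integral f_k(t) diverges; this holds on all of D when every nonzero real root of p is an eigenvalue of A. *)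

theory Defs
  imports "HOL-Analysis.Analysis"
begin

text \<open>
  On \<^typ>\<open>real ^ 'n ^ 'n\<close> the overloaded product and power are componentwise, and \<^const>\<open>exp\<close>
  is not available, so powers and the exponential are built from
  the matrix product \<^term>\<open>A ** B\<close> and the identity \<^term>\<open>mat 1\<close>.
\<close>

primrec matrix_power :: "real ^ 'n ^ 'n \<Rightarrow> nat \<Rightarrow> real ^ 'n ^ 'n" where
  "matrix_power A 0 = mat 1"
| "matrix_power A (Suc m) = A ** matrix_power A m"

definition matrix_exp :: "real ^ 'n ^ 'n \<Rightarrow> real ^ 'n ^ 'n" where
  "matrix_exp X = (\<Sum>m. (1 / fact m) *\<^sub>R matrix_power X m)"

definition matrix_spectrum :: "real ^ 'n ^ 'n \<Rightarrow> complex set" where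
  "matrix_spectrum X =
     {z. \<exists>v :: complex ^ 'n. v \<noteq> 0 \<and> map_matrix complex_of_real X *v v = z *s v}"

text \<open>
  The description below determines a unique matrix when \<open>B\<close> has no eigenvalue in \<open>(-\<infinity>, 0]\<close>;
  for other \<open>B\<close> the value is irrelevant.
\<close>

definition principal_log :: "real ^ 'n ^ 'n \<Rightarrow> real ^ 'n ^ 'n" where
  "principal_log B =
     (THE X. matrix_exp X = B \<and> (\<forall>z \<in> matrix_spectrum X. - pi < Im z \<and> Im z < pi))"

definition log_domain :: "real ^ 'n ^ 'n \<Rightarrow> real set" where
  "log_domain A =
     {t. matrix_spectrum (mat 1 - t *\<^sub>R A) \<inter> complex_of_real ` {..0} = {}}"

text \<open>
  Only the values \<open>c 1, \<dots>, c k\<close> matter: they are the coefficients of the monic polynomial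
  \<open>p(x) = x^k + c 1 * x^(k-1) + \<dots> + c k\<close>, given as a function on the reals and on matrices.
\<close>

definition monic_eval :: "(nat \<Rightarrow> real) \<Rightarrow> nat \<Rightarrow> real \<Rightarrow> real" where
  "monic_eval c k x = x ^ k + (\<Sum>m = 1..k. c m * x ^ (k - m))"

definition monic_eval_matrix :: "(nat \<Rightarrow> real) \<Rightarrow> nat \<Rightarrow> real ^ 'n ^ 'n \<Rightarrow> real ^ 'n ^ 'n" where
  "monic_eval_matrix c k A =
     matrix_power A k + (\<Sum>m = 1..k. c m *\<^sub>R matrix_power A (k - m))"

definition log_denom :: "(nat \<Rightarrow> real) \<Rightarrow> nat \<Rightarrow> real \<Rightarrow> real" where
  "log_denom c k s = 1 + (\<Sum>m = 1..k. c m * s ^ m)"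

definition log_numer :: "(nat \<Rightarrow> real) \<Rightarrow> nat \<Rightarrow> nat \<Rightarrow> real \<Rightarrow> real" where
  "log_numer c k i s =
     (if i = 1 then c k * s ^ (k - 1)
      else if i = k then - (s ^ (k - 2))
      else - (s ^ (i - 2)) - (\<Sum>m = 1..k - i. c m * s ^ (m + i - 2)))"

text \<open>
  The integral is oriented: for \<open>t < 0\<close> it is minus the integral over \<open>[t, 0]\<close>. It has its usual
  meaning when the denominator has no zero on the closed segment between \<open>0\<close> and \<open>t\<close>;
  otherwise the integral for \<open>i = k\<close> diverges, because its numerator \<open>- s^(k-2)\<close> vanishes at most
  at \<open>0\<close>, where the denominator is \<open>1\<close>.
\<close>

definition log_coeff :: "(nat \<Rightarrow> real) \<Rightarrow> nat \<Rightarrow> nat \<Rightarrow> real \<Rightarrow> real" where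
  "log_coeff c k i t =
     (LBINT s = ereal 0..ereal t. log_numer c k i s / log_denom c k s)"

end

theory Submission
  imports Defs "HOL-Computational_Algebra.Fundamental_Theorem_Algebra"
begin

text \<open>
  Write \<open>q\<close> for the common denominator and \<open>X(s) = \<Sum>i. f\<^sub>i(s) A\<^bsup>i-1\<^esup>\<close>. The numerators are
  chosen so that \<open>p(A) = 0\<close> makes \<open>(I - sA) X'(s) = - A\<close>; hence \<open>e\<^bsup>-X(s)\<^esup> (I - sA)\<close> is constant
  and \<open>e\<^bsup>X(t)\<^esup> = I - tA\<close>. Every eigenvalue of \<open>X(t)\<close> has an eigenvector that is also an
  eigenvector of \<open>A\<close>, say for \<open>\<mu>\<close>, and the same differential equation in \<open>\<complex>\<close> shows that it is the
  principal value of \<open>log (1 - t\<mu>)\<close>.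

  For uniqueness, let \<open>Y\<close> be another logarithm with spectrum in the strip. It commutes with
  \<open>e\<^bsup>Y\<^esup> = I - tA\<close> and therefore with the polynomial \<open>X\<close> in \<open>A\<close>. If \<open>Z = Y - X\<close> were nonzero, its
  range would contain a common eigenvector \<open>w = Zu\<close> of \<open>X\<close> and \<open>Y\<close>. The two eigenvalues have
  the same exponential, so they agree and \<open>Zw = 0\<close>; then \<open>u = e\<^bsup>Z\<^esup> u = u + w\<close>, a contradiction.
\<close>

section \<open>Eigenvectors in invariant subspaces\<close>

text \<open>The library notion of dependence concerns sets, whereas an indexed family may repeat a
  vector. A repetition gives a relation with coefficients 1 and -1; otherwise the image has more
  than \<open>DIM('a)\<close> elements.\<close>

lemma linear_relation_exists:
  fixes u :: "nat \<Rightarrow> 'a::euclidean_space"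
  obtains r where "\<exists>i\<le>DIM('a). r i \<noteq> (0::real)" "(\<Sum>i\<le>DIM('a). r i *\<^sub>R u i) = 0"
proof (cases "inj_on u {..DIM('a)}")
  case True
  then have "card (u ` {..DIM('a)}) > DIM('a)"
    by (simp add: card_image)
  then have "dependent (u ` {..DIM('a)})"
    using dependent_biggerset by blast
  then obtain g where g: "\<exists>v\<in>u ` {..DIM('a)}. g v \<noteq> 0" "(\<Sum>v\<in>u ` {..DIM('a)}. g v *\<^sub>R v) = 0"
    using dependent_finite by blast
  from g(2) have "(\<Sum>i\<le>DIM('a). g (u i) *\<^sub>R u i) = 0"
    by (simp add: sum.reindex[OF True])
  with g(1) show ?thesis
    by (intro that[of "g \<circ> u"]) auto
next
  case False
  then obtain i j where ij: "i \<le> DIM('a)" "j \<le> DIM('a)" "i \<noteq> j" "u i = u j"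
    by (auto simp: inj_on_def)
  define r where "r l = (if l = i then 1 else if l = j then - 1 else 0 :: real)" for l
  have "(\<Sum>l\<le>DIM('a). r l *\<^sub>R u l) = (\<Sum>l\<in>{i, j}. r l *\<^sub>R u l)"
    using ij by (intro sum.mono_neutral_right) (auto simp: r_def)
  also have "\<dots> = 0"
    using ij by (simp add: r_def)
  finally show ?thesis
    using ij by (intro that[of r]) (auto simp: r_def)
qed

text \<open>This is p(M) v by Horner's scheme. Only matrix-vector products occur, because the
  overloaded power on the matrix type is componentwise.\<close>

definition poly_act :: "complex ^ 'n ^ 'n \<Rightarrow> complex poly \<Rightarrow> complex ^ 'n \<Rightarrow> complex ^ 'n" where
  "poly_act M p v = fold_coeffs (\<lambda>a w. a *s v + M *v w) p 0"

lemma poly_act_0 [simp]: "poly_act M 0 v = 0"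
  by (simp add: poly_act_def)

lemma poly_act_pCons [simp]: "poly_act M (pCons a p) v = a *s v + M *v poly_act M p v"
  by (cases "p = 0 \<and> a = 0") (auto simp: poly_act_def)

lemma poly_act_add: "poly_act M (p + q) v = poly_act M p v + poly_act M q v"
  by (induct p q rule: poly_induct2)
    (simp_all add: vec.scale_left_distrib matrix_vector_right_distrib algebra_simps)

lemma poly_act_smult: "poly_act M (smult a p) v = a *s poly_act M p v"
  by (induct p) (simp_all add: vec.scale_right_distrib vector_scalar_commute)

text \<open>If \<open>[:- z, 1:] * p\<close> annihilates \<open>v\<close>, the vector
  \<open>poly_act M p v\<close> satisfies the eigenvector equation for \<open>z\<close>.\<close>

lemma poly_act_linear_mult:
  "poly_act M ([:- z, 1:] * p) v = M *v poly_act M p v - z *s poly_act M p v"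
proof -
  have "[:- z, 1:] * p = smult (- z) p + pCons 0 p"
    by simp
  then show ?thesis
    by (simp only: poly_act_add poly_act_smult) simp
qed

lemma poly_act_in_subspace:
  assumes "vec.subspace V" "\<And>w. w \<in> V \<Longrightarrow> M *v w \<in> V" "v \<in> V"
  shows "poly_act M p v \<in> V"
  by (induct p) (auto simp: assms vec.subspace_0 vec.subspace_add vec.subspace_scale)

lemma poly_act_sum: "poly_act M (\<Sum>i\<in>I. p i) v = (\<Sum>i\<in>I. poly_act M (p i) v)"
  by (induct I rule: infinite_finite_induct) (simp_all add: poly_act_add)

lemma poly_act_monom: "poly_act M (monom a i) v = a *s ((*v) M ^^ i) v"
  by (induct i) (simp_all add: monom_0 monom_Suc vector_scalar_commute)

text \<open>The vectors v, Mv, ..., M^d v, with d the real dimension of the space, satisfy a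
  nontrivial real linear relation; its coefficients are those of the polynomial.\<close>

lemma annihilating_poly_exists:
  fixes M :: "complex ^ 'n ^ 'n"
  obtains p where "p \<noteq> 0" "poly_act M p v = 0"
proof -
  let ?u = "\<lambda>i. ((*v) M ^^ i) v" and ?d = "DIM(complex ^ 'n)"
  obtain r where r: "\<exists>i\<le>?d. r i \<noteq> (0::real)" "(\<Sum>i\<le>?d. r i *\<^sub>R ?u i) = 0"
    by (rule linear_relation_exists[of ?u])
  define p where "p = (\<Sum>i\<le>?d. monom (complex_of_real (r i)) i)"
  have "coeff p j = of_real (r j)" if "j \<le> ?d" for j
    using that by (simp add: p_def coeff_sum)
  with r(1) have "p \<noteq> 0"
    by (metis coeff_0 of_real_eq_0_iff)
  moreover have "of_real a *s w = a *\<^sub>R w" for a and w :: "complex ^ 'n"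
    by (simp add: vec_eq_iff) (simp add: scaleR_conv_of_real)
  then have "poly_act M p v = 0"
    using r(2) by (simp add: p_def poly_act_sum poly_act_monom)
  ultimately show ?thesis
    by (rule that)
qed

text \<open>Take a nonzero p of least degree with p(M) v = 0 and split off a root: p = (x - z) q. By
  minimality q(M) v is nonzero, so it is an eigenvector for \<open>z\<close>, and it stays in the
  invariant subspace.\<close>

lemma invariant_subspace_eigenvector:
  fixes M :: "complex ^ 'n ^ 'n"
  assumes V: "vec.subspace V" "\<And>w. w \<in> V \<Longrightarrow> M *v w \<in> V" and v: "v \<in> V" "v \<noteq> 0"
  obtains w z where "w \<in> V" "w \<noteq> 0" "M *v w = z *s w"
proof -
  let ?P = "\<lambda>p. p \<noteq> 0 \<and> poly_act M p v = 0"
  obtain p where p: "?P p" and min: "\<And>q. ?P q \<Longrightarrow> degree p \<le> degree q"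
    using ex_has_least_nat[of ?P _ degree] annihilating_poly_exists[of M v] by metis
  have "degree p \<noteq> 0"
  proof
    assume "degree p = 0"
    then obtain a where "p = [:a:]"
      using degree_eq_zeroE by blast
    with p v show False by simp
  qed
  then obtain z where "poly p z = 0"
    using fundamental_theorem_of_algebra constant_degree by metis
  then obtain q where q: "p = [:- z, 1:] * q"
    by (meson dvdE poly_eq_0_iff_dvd)
  with p have "q \<noteq> 0" by auto
  then have "degree p = Suc (degree q)"
    unfolding q by (subst degree_mult_eq) auto
  with min \<open>q \<noteq> 0\<close> have "poly_act M q v \<noteq> 0"
    by force
  moreover have "M *v poly_act M q v = z *s poly_act M q v"
    using p unfolding q poly_act_linear_mult by simp
  ultimately show ?thesis
    using that poly_act_in_subspace[OF V v(1)] by blast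
qed

section \<open>The Banach algebra of real square matrices\<close>

text \<open>
  The library exponential needs a unital Banach algebra. The product of \<^typ>\<open>real ^ 'n ^ 'n\<close> is
  componentwise and its norm does not give the identity matrix norm 1, hence a copy of the type
  with the matrix product and the operator norm.
\<close>

typedef 'n mat_alg = "UNIV :: (real ^ 'n ^ 'n) set"
  morphisms to_mat of_mat ..

setup_lifting type_definition_mat_alg

instantiation mat_alg :: (finite) real_normed_algebra_1
begin

lift_definition zero_mat_alg :: "'a mat_alg" is 0 .
lift_definition one_mat_alg :: "'a mat_alg" is "mat 1" .
lift_definition plus_mat_alg :: "'a mat_alg \<Rightarrow> 'a mat_alg \<Rightarrow> 'a mat_alg" is "(+)" .
lift_definition minus_mat_alg :: "'a mat_alg \<Rightarrow> 'a mat_alg \<Rightarrow> 'a mat_alg" is "(-)" .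
lift_definition uminus_mat_alg :: "'a mat_alg \<Rightarrow> 'a mat_alg" is uminus .
lift_definition times_mat_alg :: "'a mat_alg \<Rightarrow> 'a mat_alg \<Rightarrow> 'a mat_alg" is "(**)" .
lift_definition scaleR_mat_alg :: "real \<Rightarrow> 'a mat_alg \<Rightarrow> 'a mat_alg" is scaleR .
lift_definition norm_mat_alg :: "'a mat_alg \<Rightarrow> real" is "\<lambda>M. onorm ((*v) M)" .

definition dist_mat_alg :: "'a mat_alg \<Rightarrow> 'a mat_alg \<Rightarrow> real" where
  "dist_mat_alg A B = norm (A - B)"
definition sgn_mat_alg :: "'a mat_alg \<Rightarrow> 'a mat_alg" where
  "sgn_mat_alg A = scaleR (inverse (norm A)) A"
definition uniformity_mat_alg :: "('a mat_alg \<times> 'a mat_alg) filter" where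
  "uniformity_mat_alg = (INF e\<in>{0<..}. principal {(A, B). dist A B < e})"
definition open_mat_alg :: "'a mat_alg set \<Rightarrow> bool" where
  "open_mat_alg U \<longleftrightarrow> (\<forall>A\<in>U. eventually (\<lambda>(A', B). A' = A \<longrightarrow> B \<in> U) uniformity)"

instance
proof
  fix A B C :: "'a mat_alg" and a b :: real and U :: "'a mat_alg set"
  show "A + B + C = A + (B + C)" "A + B = B + A" "0 + A = A" "- A + A = 0" "A - B = A + - B"
    by (transfer; simp)+
  show "a *\<^sub>R (A + B) = a *\<^sub>R A + a *\<^sub>R B" "(a + b) *\<^sub>R A = a *\<^sub>R A + b *\<^sub>R A"
    "a *\<^sub>R b *\<^sub>R A = (a * b) *\<^sub>R A" "1 *\<^sub>R A = A"
    by (transfer; simp add: algebra_simps)+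
  show "A * B * C = A * (B * C)"
    by transfer (simp add: matrix_mul_assoc)
  show "1 * A = A" "A * 1 = A"
    by (transfer; simp)+
  show "(A + B) * C = A * C + B * C"
    by transfer (simp add: matrix_matrix_mult_def vec_eq_iff sum.distrib distrib_right)
  show "A * (B + C) = A * B + A * C"
    by transfer (simp add: matrix_add_ldistrib)
  show "a *\<^sub>R A * B = a *\<^sub>R (A * B)"
    by transfer (simp add: scalar_matrix_assoc)
  show "A * a *\<^sub>R B = a *\<^sub>R (A * B)"
    by transfer (simp add: matrix_scalar_ac scalar_matrix_assoc)
  show "(0 :: 'a mat_alg) \<noteq> 1"
    by transfer (auto simp: vec_eq_iff mat_def)
  show "dist A B = norm (A - B)" "sgn A = scaleR (inverse (norm A)) A"
    "uniformity = (INF e\<in>{0<..}. principal {(A, B :: 'a mat_alg). dist A B < e})"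
    "open U \<longleftrightarrow> (\<forall>A\<in>U. eventually (\<lambda>(A', B). A' = A \<longrightarrow> B \<in> U) uniformity)"
    by (fact dist_mat_alg_def sgn_mat_alg_def uniformity_mat_alg_def open_mat_alg_def)+
  show "norm A = 0 \<longleftrightarrow> A = 0"
    by transfer (simp add: onorm_eq_0[OF matrix_vector_mul_bounded_linear] matrix_eq)
  show "norm (A + B) \<le> norm A + norm B"
  proof transfer
    fix A B :: "real ^ 'a ^ 'a"
    have "(*v) (A + B) = (\<lambda>x. A *v x + B *v x)"
      by (simp add: fun_eq_iff matrix_vector_mult_add_rdistrib)
    then show "onorm ((*v) (A + B)) \<le> onorm ((*v) A) + onorm ((*v) B)"
      by (simp add: onorm_triangle matrix_vector_mul_bounded_linear)
  qed
  show "norm (a *\<^sub>R A) = \<bar>a\<bar> * norm A"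
  proof transfer
    fix a and A :: "real ^ 'a ^ 'a"
    have "(*v) (a *\<^sub>R A) = (\<lambda>x. a *\<^sub>R (A *v x))"
      by (simp add: fun_eq_iff scaleR_matrix_vector_assoc)
    then show "onorm ((*v) (a *\<^sub>R A)) = \<bar>a\<bar> * onorm ((*v) A)"
      by (simp add: onorm_scaleR matrix_vector_mul_bounded_linear)
  qed
  show "norm (A * B) \<le> norm A * norm B"
  proof transfer
    fix A B :: "real ^ 'a ^ 'a"
    show "onorm ((*v) (A ** B)) \<le> onorm ((*v) A) * onorm ((*v) B)"
      using onorm_compose[OF matrix_vector_mul_bounded_linear[of A] matrix_vector_mul_bounded_linear[of B]]
      by (simp add: o_def matrix_vector_mul_assoc)
  qed
  show "norm (1 :: 'a mat_alg) = 1"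
  proof transfer
    have "(*v) (mat 1) = (\<lambda>x :: real ^ 'a. x)"
      by (simp add: fun_eq_iff)
    then show "onorm ((*v) (mat 1 :: real ^ 'a ^ 'a)) = 1"
      by (simp add: onorm_id)
  qed
qed

end

lemma to_mat_component_le_norm: "\<bar>to_mat M $ i $ j\<bar> \<le> norm M"
  by transfer (rule matrix_component_le_onorm)

text \<open>The operator norm dominates each entry and is dominated by the sum of the absolute
  entries. Hence the entrywise limit of a Cauchy sequence is also its limit in norm.\<close>

instance mat_alg :: (finite) banach
proof
  fix X :: "nat \<Rightarrow> 'a mat_alg"
  assume X: "Cauchy X"
  have "Cauchy (\<lambda>n. to_mat (X n) $ i $ j)" for i j
  proof (rule metric_CauchyI)
    fix e :: real
    assume "e > 0"
    then obtain N where "\<forall>m\<ge>N. \<forall>n\<ge>N. dist (X m) (X n) < e"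
      using X by (meson metric_CauchyD)
    moreover have "dist (to_mat (X m) $ i $ j) (to_mat (X n) $ i $ j) \<le> dist (X m) (X n)" for m n
      using to_mat_component_le_norm[of "X m - X n" i j]
      by (simp add: dist_norm minus_mat_alg.rep_eq)
    ultimately show "\<exists>N. \<forall>m\<ge>N. \<forall>n\<ge>N. dist (to_mat (X m) $ i $ j) (to_mat (X n) $ i $ j) < e"
      by (meson le_less_trans)
  qed
  then have "\<exists>l. (\<lambda>n. to_mat (X n) $ i $ j) \<longlonglongrightarrow> l" for i j
    by (simp add: Cauchy_convergent_iff convergent_def)
  then obtain L where L: "(\<lambda>n. to_mat (X n) $ i $ j) \<longlonglongrightarrow> L i j" for i j
    by metis
  let ?s = "\<lambda>n. \<Sum>i\<in>UNIV. \<Sum>j\<in>UNIV. \<bar>to_mat (X n) $ i $ j - L i j\<bar>"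
  have "?s \<longlonglongrightarrow> (\<Sum>i\<in>(UNIV :: 'a set). \<Sum>j\<in>(UNIV :: 'a set). \<bar>L i j - L i j\<bar>)"
    by (intro tendsto_intros L)
  then have "?s \<longlonglongrightarrow> 0"
    by simp
  moreover have "norm (X n - of_mat (\<chi> i j. L i j)) \<le> ?s n" for n
    using onorm_le_matrix_component_sum[of "to_mat (X n) - (\<chi> i j. L i j)"]
    by (simp add: norm_mat_alg.rep_eq minus_mat_alg.rep_eq of_mat_inverse)
  then have "\<forall>\<^sub>F n in sequentially. norm (X n - of_mat (\<chi> i j. L i j)) \<le> ?s n"
    by simp
  ultimately have "(\<lambda>n. X n - of_mat (\<chi> i j. L i j)) \<longlonglongrightarrow> 0"
    by (rule Lim_null_comparison[rotated])
  then show "convergent X"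
    unfolding convergent_def by (blast intro: LIM_zero_cancel)
qed

text \<open>Carries finite sums and convergent series from the Banach algebra back to the original
  matrix type, whose norm is a different one.\<close>

lemma bounded_linear_to_mat: "bounded_linear to_mat"
proof (rule bounded_linear_intro)
  fix M N :: "('n::finite) mat_alg" and a :: real
  show "to_mat (M + N) = to_mat M + to_mat N" "to_mat (a *\<^sub>R M) = a *\<^sub>R to_mat M"
    by (simp_all add: plus_mat_alg.rep_eq scaleR_mat_alg.rep_eq)
  have "norm (to_mat M) \<le> (\<Sum>i\<in>UNIV. norm (to_mat M $ i))"
    by (simp add: norm_vec_def L2_set_le_sum)
  also have "\<dots> \<le> (\<Sum>i\<in>UNIV. \<Sum>j\<in>UNIV. \<bar>to_mat M $ i $ j\<bar>)"
    by (intro sum_mono norm_le_l1_cart)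
  also have "\<dots> \<le> (\<Sum>i\<in>(UNIV :: 'n set). \<Sum>j\<in>(UNIV :: 'n set). norm M)"
    by (intro sum_mono to_mat_component_le_norm)
  finally show "norm (to_mat M) \<le> norm M * (real CARD('n) * real CARD('n))"
    by (simp add: mult_ac)
qed

lemma to_mat_power: "to_mat (M ^ m) = matrix_power (to_mat M) m"
  by (induct m) (simp_all add: one_mat_alg.rep_eq times_mat_alg.rep_eq)

lemma matrix_exp_sums:
  "(\<lambda>m. (1 / fact m) *\<^sub>R matrix_power (to_mat M) m) sums to_mat (exp M)"
  using bounded_linear.sums[OF bounded_linear_to_mat exp_converges[of M]]
  by (simp add: to_mat_power scaleR_mat_alg.rep_eq inverse_eq_divide)

lemma matrix_exp_to_mat: "matrix_exp (to_mat M) = to_mat (exp M)"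
  unfolding matrix_exp_def by (rule sums_unique[symmetric, OF matrix_exp_sums])

section \<open>The coefficient functions\<close>

text \<open>Multiplication by sA shifts the numerators by one index, up to a multiple of s^(k-1) in
  each term and one copy of q(s) A. The relation p(A) = 0 collapses the multiples of s^(k-1) to the
  constant term, which cancels against the first numerator. Stating this for any real algebra covers
  both matrices and complex eigenvalues.\<close>

lemma sum_numer_telescope:
  fixes A :: "'a::real_algebra_1"
  assumes k: "k \<ge> 2" and A: "A ^ k + (\<Sum>m = 1..k. c m *\<^sub>R A ^ (k - m)) = 0"
  shows "(1 - s *\<^sub>R A) * (\<Sum>i = 1..k. log_numer c k i s *\<^sub>R A ^ (i - 1)) = - (log_denom c k s *\<^sub>R A)"
proof -
  define c' where "c' m = (if m = 0 then 1 else c m)" for m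
  \<comment> \<open>With c_0 = 1 one formula serves all i from 2 to k + 1: for i = k a single
    summand remains, and for i = k + 1 the range is empty, so the shifted sum may run one index too
    far.\<close>
  define n where "n i = (if i = 1 then c k * s ^ (k - 1)
    else - (\<Sum>m<k + 1 - i. c' m * s ^ (m + i - 2)))" for i
  have numer: "log_numer c k i s = n i" if "i \<in> {1..k}" for i
  proof -
    have "(\<Sum>m<k + 1 - i. c' m * s ^ (m + i - 2)) =
        s ^ (i - 2) + (\<Sum>m = 1..k - i. c m * s ^ (m + i - 2))"
    proof -
      have "{..<k + 1 - i} = insert 0 {1..k - i}"
        using that by auto
      then show ?thesis
        by (simp add: c'_def)
    qed
    then show ?thesis
      using that k by (auto simp: log_numer_def n_def)
  qed
  have last: "n (k + 1) = 0"
    using k by (simp add: n_def)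
  \<comment> \<open>For i = 1, \<open>n 2\<close> contains all terms of -q except those of degree k
    - 1 and k, and \<open>s * n 1\<close> is the term of degree k. For larger i, passing from
    \<open>n i\<close> to \<open>n (i + 1)\<close> drops the summand m = k - i, which has degree k -
    1 after multiplication by s.\<close>
  have step: "s * n i = n (i + 1) - c' (k - i) * s ^ (k - 1)
      + (if i = 1 then log_denom c k s else 0)" if i: "i \<in> {1..k}" for i
  proof (cases "i = 1")
    case True
    have "{1..k} = insert k (insert (k - 1) {1..<k - 1})" "{..<k - 1} = insert 0 {1..<k - 1}"
      "k \<noteq> k - 1"
      using k by auto
    then have "log_denom c k s = 1 + (c k * s ^ k + (c (k - 1) * s ^ (k - 1) + (\<Sum>m = 1..<k - 1. c m * s ^ m)))"
      "n 2 = - (1 + (\<Sum>m = 1..<k - 1. c m * s ^ m))"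
      using k by (simp_all add: log_denom_def n_def c'_def)
    moreover have "s * n 1 = c k * s ^ k"
      using k by (cases k) (simp_all add: n_def)
    ultimately show ?thesis
      using True k by (simp add: c'_def numeral_2_eq_2)
  next
    case False
    have "s * (c' m * s ^ (m + i - 2)) = c' m * s ^ (m + (i + 1) - 2)" for m
    proof -
      \<comment> \<open>Subtraction on naturals truncates, so this uses i at least 2.\<close>
      have "Suc (m + i - 2) = m + (i + 1) - 2"
        using i False by auto
      then show ?thesis
        by (metis mult.left_commute power_Suc)
    qed
    then have "s * n i = - (\<Sum>m<k + 1 - i. c' m * s ^ (m + (i + 1) - 2))"
      by (simp only: n_def False if_False mult_minus_right sum_distrib_left)
    also have "{..<k + 1 - i} = insert (k - i) {..<k + 1 - (i + 1)}"
      using i by auto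
    finally show ?thesis
      using i False by (simp add: n_def)
  qed
  let ?N = "\<Sum>i = 1..k. n i *\<^sub>R A ^ (i - 1)"
  have "s *\<^sub>R A * ?N = (\<Sum>i = 1..k. (s * n i) *\<^sub>R A ^ i)"
    unfolding sum_distrib_left
  proof (intro sum.cong refl)
    fix i
    assume "i \<in> {1..k}"
    then show "s *\<^sub>R A * (n i *\<^sub>R A ^ (i - 1)) = (s * n i) *\<^sub>R A ^ i"
      by (cases i) simp_all
  qed
  also have "\<dots> = (\<Sum>i = 1..k. n (i + 1) *\<^sub>R A ^ i) - s ^ (k - 1) *\<^sub>R (\<Sum>i = 1..k. c' (k - i) *\<^sub>R A ^ i)
      + (\<Sum>i = 1..k. (if i = 1 then log_denom c k s *\<^sub>R A else 0))"
    unfolding scaleR_sum_right sum_subtractf[symmetric] sum.distrib[symmetric]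
    by (intro sum.cong refl) (simp add: step algebra_simps)
  also have "(\<Sum>i = 1..k. (if i = 1 then log_denom c k s *\<^sub>R A else 0)) = log_denom c k s *\<^sub>R A"
    using k by (simp add: sum.delta)
  \<comment> \<open>The left side is p(A) without its constant term; this is where p(A) = 0
    enters.\<close>
  also have "(\<Sum>i = 1..k. c' (k - i) *\<^sub>R A ^ i) = - (c k *\<^sub>R 1)"
  proof -
    have "(\<Sum>i = 1..k. c' (k - i) *\<^sub>R A ^ i) = (\<Sum>m = 0..<k. c' m *\<^sub>R A ^ (k - m))"
      by (rule sum.reindex_bij_witness[of _ "\<lambda>m. k - m" "\<lambda>m. k - m"]) auto
    also have "{0..<k} = insert 0 {1..<k}"
      using k by auto
    also have "(\<Sum>m\<in>insert 0 {1..<k}. c' m *\<^sub>R A ^ (k - m)) = A ^ k + (\<Sum>m = 1..<k. c m *\<^sub>R A ^ (k - m))"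
      by (simp add: c'_def)
    also have "\<dots> = - (c k *\<^sub>R 1)"
    proof -
      have "{1..k} = insert k {1..<k}"
        using k by auto
      then show ?thesis
        using A by (simp add: algebra_simps eq_neg_iff_add_eq_0)
    qed
    finally show ?thesis .
  qed
  also have "(\<Sum>i = 1..k. n (i + 1) *\<^sub>R A ^ i) = ?N - n 1 *\<^sub>R 1"
  proof -
    have "(\<Sum>i = 1..k. n (i + 1) *\<^sub>R A ^ i) = (\<Sum>i = 2..k+1. n i *\<^sub>R A ^ (i - 1))"
      by (rule sum.reindex_bij_witness[of _ "\<lambda>i. i - 1" "\<lambda>i. i + 1"]) auto
    also have "{2..k+1} = insert (k + 1) {2..k}"
      using k by auto
    also have "(\<Sum>i\<in>insert (k + 1) {2..k}. n i *\<^sub>R A ^ (i - 1)) = (\<Sum>i = 2..k. n i *\<^sub>R A ^ (i - 1))"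
      using last by simp
    also have "\<dots> = ?N - n 1 *\<^sub>R 1"
    proof -
      have "{1..k} = insert 1 {2..k}"
        using k by auto
      then show ?thesis
        by simp
    qed
    finally show ?thesis .
  qed
  finally have "s *\<^sub>R A * ?N = ?N + log_denom c k s *\<^sub>R A"
    by (simp add: n_def)
  then show ?thesis
    by (simp add: numer left_diff_distrib)
qed

section \<open>Differentiability of the coefficient functions\<close>

lemma continuous_on_log_denom: "continuous_on S (log_denom c k)"
  unfolding log_denom_def[abs_def] by (intro continuous_intros)

lemma continuous_on_log_numer: "continuous_on S (log_numer c k i)"
  unfolding log_numer_def[abs_def] by (cases "i = 1"; cases "i = k"; simp; intro continuous_intros)

text \<open>Non-vanishing is an open condition, so the segment can be enlarged on both sides. This
  puts 0 and t in the interior, where two-sided derivatives exist.\<close>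

lemma log_denom_nonzero_interval:
  assumes "\<And>s. s \<in> closed_segment 0 t \<Longrightarrow> log_denom c k s \<noteq> 0"
  obtains a b where "a < min 0 t" "max 0 t < b" "\<And>s. s \<in> {a..b} \<Longrightarrow> log_denom c k s \<noteq> 0"
proof -
  let ?S = "{s. log_denom c k s \<noteq> 0}"
  have "open ?S"
    using continuous_on_log_denom by (intro open_Collect_neq) auto
  moreover have "min 0 t \<in> ?S" "max 0 t \<in> ?S"
    using assms by (auto simp: closed_segment_eq_real_ivl min_def max_def)
  ultimately obtain d e where "d > 0" "cball (min 0 t) d \<subseteq> ?S" "e > 0" "cball (max 0 t) e \<subseteq> ?S"
    by (metis open_contains_cball)
  then have de: "d > 0" "{min 0 t - d..min 0 t + d} \<subseteq> ?S" "e > 0" "{max 0 t - e..max 0 t + e} \<subseteq> ?S"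
    by (simp_all add: cball_eq_atLeastAtMost)
  show ?thesis
  proof
    show "min 0 t - d < min 0 t" "max 0 t < max 0 t + e"
      using de by auto
    fix s
    assume "s \<in> {min 0 t - d..max 0 t + e}"
    then have "s \<in> {min 0 t - d..min 0 t + d} \<or> s \<in> closed_segment 0 t
        \<or> s \<in> {max 0 t - e..max 0 t + e}"
      using de(1,3) by (auto simp: closed_segment_eq_real_ivl min_def max_def)
    then show "log_denom c k s \<noteq> 0"
      using de assms by blast
  qed
qed

lemma log_coeff_has_vector_derivative:
  assumes "\<And>s. s \<in> {a..b} \<Longrightarrow> log_denom c k s \<noteq> 0" "a < 0" "0 < b" "s \<in> {a<..<b}"
  shows "(log_coeff c k i has_vector_derivative log_numer c k i s / log_denom c k s) (at s)"
proof -
  have "((\<lambda>u. LBINT y=ereal 0..ereal u. log_numer c k i y / log_denom c k y) has_vector_derivative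
      log_numer c k i s / log_denom c k s) (at s within {a..b})"
    by (rule interval_integral_FTC2)
      (use assms in \<open>auto intro!: continuous_on_divide continuous_on_log_numer continuous_on_log_denom\<close>)
  then have "(log_coeff c k i has_vector_derivative log_numer c k i s / log_denom c k s) (at s within {a..b})"
    by (simp add: log_coeff_def[abs_def])
  moreover have "at s within {a..b} = at s"
    using assms(4) by (intro at_within_interior) auto
  ultimately show ?thesis
    by simp
qed

lemma log_coeff_0: "log_coeff c k i 0 = 0"
  by (simp add: log_coeff_def)

text \<open>The differential equation X'(s) (1 - sA) = -A. The sum is a polynomial in A, so the
  factor may be moved to the right, where the product rule will need it.\<close>

lemma sum_numer_over_denom:
  fixes A :: "'a::real_algebra_1"
  assumes "k \<ge> 2" "A ^ k + (\<Sum>m = 1..k. c m *\<^sub>R A ^ (k - m)) = 0" "log_denom c k s \<noteq> 0"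
  shows "(\<Sum>i = 1..k. (log_numer c k i s / log_denom c k s) *\<^sub>R A ^ (i - 1)) * (1 - s *\<^sub>R A) = - A"
proof -
  have comm: "X * (1 - s *\<^sub>R A) = (1 - s *\<^sub>R A) * X" if "X * A = A * X" for X
    using that by (simp add: algebra_simps)
  have "(\<Sum>i = 1..k. (log_numer c k i s / log_denom c k s) *\<^sub>R A ^ (i - 1)) * A =
      A * (\<Sum>i = 1..k. (log_numer c k i s / log_denom c k s) *\<^sub>R A ^ (i - 1))"
    by (simp add: sum_distrib_left sum_distrib_right power_commutes)
  note comm[OF this]
  moreover have "(\<Sum>i = 1..k. (log_numer c k i s / log_denom c k s) *\<^sub>R A ^ (i - 1)) =
      (1 / log_denom c k s) *\<^sub>R (\<Sum>i = 1..k. log_numer c k i s *\<^sub>R A ^ (i - 1))"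
    by (simp add: scaleR_sum_right)
  ultimately show ?thesis
    using sum_numer_telescope[OF assms(1,2), of s] assms(3) by simp
qed

section \<open>Integrating the differential equation\<close>

lemma exp_mult_commute:
  fixes x y :: "'a::{real_normed_algebra_1,banach}"
  assumes "x * y = y * x"
  shows "exp x * y = y * exp x"
  using power_commuting_commutes[OF assms]
  by (simp add: exp_def suminf_mult[symmetric] suminf_mult2 summable_exp_generic)

text \<open>The scalar chain rule for the exponential can fail without commutativity. Since the
  \<open>B i\<close> commute, the exponential splits into one factor per index, and induction with
  the product rule applies.\<close>

lemma exp_sum_has_vector_derivative:
  fixes B :: "'i \<Rightarrow> 'a::{real_normed_algebra_1,banach}"
  assumes "finite I" "\<And>i. i \<in> I \<Longrightarrow> (f i has_vector_derivative f' i) (at s within S)"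
    and "\<And>i j. i \<in> I \<Longrightarrow> j \<in> I \<Longrightarrow> B i * B j = B j * B i"
  shows "((\<lambda>s. exp (\<Sum>i\<in>I. f i s *\<^sub>R B i)) has_vector_derivative
    exp (\<Sum>i\<in>I. f i s *\<^sub>R B i) * (\<Sum>i\<in>I. f' i *\<^sub>R B i)) (at s within S)"
  using assms
proof (induction I)
  case empty
  then show ?case by simp
next
  case (insert j I)
  let ?S = "\<lambda>s. \<Sum>i\<in>I. f i s *\<^sub>R B i" and ?S' = "\<Sum>i\<in>I. f' i *\<^sub>R B i"
  have comm: "?S u * B j = B j * ?S u" "?S' * B j = B j * ?S'" for u
    using insert.prems(2) by (simp_all add: sum_distrib_left sum_distrib_right)
  have split: "exp (f j u *\<^sub>R B j + ?S u) = exp (?S u) * exp (f j u *\<^sub>R B j)" for u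
    by (subst add.commute, rule exp_add_commuting) (simp add: comm)
  have commE: "exp (f j s *\<^sub>R B j) * ?S' = ?S' * exp (f j s *\<^sub>R B j)"
    by (rule exp_mult_commute) (simp add: comm)
  have "(f j has_vector_derivative f' j) (at s within S)"
    using insert.prems(1) by simp
  then have "((\<lambda>u. exp (f j u *\<^sub>R B j)) has_vector_derivative f' j *\<^sub>R (exp (f j s *\<^sub>R B j) * B j)) (at s within S)"
    using vector_diff_chain_within[of "f j" "f' j" s S "\<lambda>x. exp (x *\<^sub>R B j)",
        OF _ exp_scaleR_has_vector_derivative_right]
    by (simp add: o_def)
  from has_vector_derivative_mult[OF insert.IH this]
  have "((\<lambda>u. exp (?S u) * exp (f j u *\<^sub>R B j)) has_vector_derivative
      exp (?S s) * (f' j *\<^sub>R (exp (f j s *\<^sub>R B j) * B j)) + exp (?S s) * ?S' * exp (f j s *\<^sub>R B j)) (at s within S)"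
    using insert.prems by simp
  moreover have "exp (?S s) * (f' j *\<^sub>R (exp (f j s *\<^sub>R B j) * B j)) + exp (?S s) * ?S' * exp (f j s *\<^sub>R B j)
      = exp (?S s) * exp (f j s *\<^sub>R B j) * (f' j *\<^sub>R B j + ?S')"
    by (simp add: commE distrib_left mult.assoc)
  ultimately show ?case
    using insert.hyps by (simp add: split)
qed

lemma exp_log_sum:
  fixes A :: "'a::{real_normed_algebra_1,banach}"
  assumes k: "k \<ge> 2" and A: "A ^ k + (\<Sum>m = 1..k. c m *\<^sub>R A ^ (k - m)) = 0"
    and denom: "\<And>s. s \<in> closed_segment 0 t \<Longrightarrow> log_denom c k s \<noteq> 0"
  shows "exp (\<Sum>i = 1..k. log_coeff c k i t *\<^sub>R A ^ (i - 1)) = 1 - t *\<^sub>R A"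
proof -
  obtain a b where ab: "a < min 0 t" "max 0 t < b" "\<And>s. s \<in> {a..b} \<Longrightarrow> log_denom c k s \<noteq> 0"
    using log_denom_nonzero_interval[OF denom] by metis
  let ?X = "\<lambda>s. \<Sum>i = 1..k. log_coeff c k i s *\<^sub>R A ^ (i - 1)"
  let ?E = "\<lambda>s. exp (- ?X s)"
  have "((\<lambda>s. ?E s * (1 - s *\<^sub>R A)) has_vector_derivative 0) (at s)" if s: "s \<in> {a<..<b}" for s
  proof -
    let ?X' = "\<Sum>i = 1..k. (log_numer c k i s / log_denom c k s) *\<^sub>R A ^ (i - 1)"
    \<comment> \<open>The minus sign is moved into the coefficients to match the derivative rule for
      exponentials of sums.\<close>
    have "((\<lambda>s. exp (\<Sum>i = 1..k. (- log_coeff c k i s) *\<^sub>R A ^ (i - 1))) has_vector_derivative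
      exp (\<Sum>i = 1..k. (- log_coeff c k i s) *\<^sub>R A ^ (i - 1)) *
      (\<Sum>i = 1..k. (- (log_numer c k i s / log_denom c k s)) *\<^sub>R A ^ (i - 1))) (at s)"
      using ab s
      by (intro exp_sum_has_vector_derivative has_vector_derivative_minus
          log_coeff_has_vector_derivative[of a b]) (auto simp flip: power_add simp: add.commute)
    then have E: "(?E has_vector_derivative ?E s * - ?X') (at s)"
      by (simp add: sum_negf)
    have L: "((\<lambda>s. 1 - s *\<^sub>R A) has_vector_derivative - A) (at s)"
      by (auto intro!: derivative_eq_intros)
    have "?E s * - A + ?E s * - ?X' * (1 - s *\<^sub>R A) = 0"
      using sum_numer_over_denom[OF k A, of s] ab(3)[of s] s by (simp add: mult.assoc)
    then show ?thesis
      using has_vector_derivative_mult[OF E L] by simp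
  qed
  then have "((\<lambda>s. ?E s * (1 - s *\<^sub>R A)) has_derivative (\<lambda>h. 0)) (at s within {a<..<b})"
    if "s \<in> {a<..<b}" for s
    using that by (auto simp: has_vector_derivative_def intro: has_derivative_at_withinI)
  then obtain C where C: "\<And>s. s \<in> {a<..<b} \<Longrightarrow> ?E s * (1 - s *\<^sub>R A) = C"
    using has_derivative_zero_constant[of "{a<..<b}" "\<lambda>s. ?E s * (1 - s *\<^sub>R A)"] by auto
  \<comment> \<open>The constant is found at s = 0, where every coefficient function
    vanishes.\<close>
  have "?E t * (1 - t *\<^sub>R A) = 1"
    using C[of t] C[of 0] ab by (simp add: log_coeff_0)
  then have "exp (?X t) * (?E t * (1 - t *\<^sub>R A)) = exp (?X t)"
    by simp
  then show ?thesis
    by (simp add: exp_minus_inverse flip: mult.assoc)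
qed

text \<open>Both sides vanish at 0 and have derivative -z / (1 - sz) along the segment. Comparing
  exponentials would leave a multiple of 2 pi i open; avoiding the slit throughout the segment fixes
  the branch.\<close>

lemma log_sum_eq_Ln:
  fixes z :: complex
  assumes k: "k \<ge> 2" and z: "z ^ k + (\<Sum>m = 1..k. c m *\<^sub>R z ^ (k - m)) = 0"
    and denom: "\<And>s. s \<in> closed_segment 0 t \<Longrightarrow> log_denom c k s \<noteq> 0"
    and slit: "\<And>s. s \<in> closed_segment 0 t \<Longrightarrow> 1 - s *\<^sub>R z \<notin> \<real>\<^sub>\<le>\<^sub>0"
  shows "(\<Sum>i = 1..k. log_coeff c k i t *\<^sub>R z ^ (i - 1)) = Ln (1 - t *\<^sub>R z)"
proof -
  obtain a b where ab: "a < min 0 t" "max 0 t < b" "\<And>s. s \<in> {a..b} \<Longrightarrow> log_denom c k s \<noteq> 0"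
    using log_denom_nonzero_interval[OF denom] by metis
  let ?h = "\<lambda>s. (\<Sum>i = 1..k. log_coeff c k i s *\<^sub>R z ^ (i - 1)) - Ln (1 - s *\<^sub>R z)"
  have "(?h has_vector_derivative 0) (at s)" if s: "s \<in> closed_segment 0 t" for s
  proof -
    let ?X' = "\<Sum>i = 1..k. (log_numer c k i s / log_denom c k s) *\<^sub>R z ^ (i - 1)"
    have sab: "s \<in> {a<..<b}"
      using s ab by (auto simp: closed_segment_eq_real_ivl split: if_splits)
    have "((\<lambda>s. \<Sum>i = 1..k. log_coeff c k i s *\<^sub>R z ^ (i - 1)) has_vector_derivative ?X') (at s)"
      using ab sab by (intro has_vector_derivative_sum bounded_linear.has_vector_derivative
          [OF bounded_linear_scaleR_left] log_coeff_has_vector_derivative[of a b]) auto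
    moreover have "((\<lambda>s. 1 - s *\<^sub>R z) has_vector_derivative - z) (at s)"
      by (auto intro!: derivative_eq_intros)
    then have "((\<lambda>s. Ln (1 - s *\<^sub>R z)) has_vector_derivative - z * inverse (1 - s *\<^sub>R z)) (at s)"
      using field_vector_diff_chain_at[where f = "\<lambda>s. 1 - s *\<^sub>R z" and f' = "- z", OF _ has_field_derivative_Ln[OF slit[OF s]]]
      by (simp add: o_def)
    moreover have "?X' = - z * inverse (1 - s *\<^sub>R z)"
      using sum_numer_over_denom[OF k z denom[OF s]] slit[OF s]
      by (metis eq_divide_imp divide_inverse nonpos_Reals_zero_I)
    ultimately show ?thesis
      using has_vector_derivative_diff by fastforce
  qed
  then have "(?h has_derivative (\<lambda>h. 0)) (at s within closed_segment 0 t)"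
    if "s \<in> closed_segment 0 t" for s
    using that by (auto simp: has_vector_derivative_def intro: has_derivative_at_withinI)
  then obtain C where C: "\<And>s. s \<in> closed_segment 0 t \<Longrightarrow> ?h s = C"
    using has_derivative_zero_constant[of "closed_segment 0 t" ?h] by auto
  show ?thesis
    using C[of t] C[of 0] by (simp add: log_coeff_0)
qed

section \<open>Real matrices acting on complex vectors\<close>

text \<open>The complexified action: \<open>matrix_spectrum\<close> asks for complex eigenvectors,
  while \<open>X\<close> keeps the real type on which \<open>matrix_exp\<close> is defined.
  Linearity in \<open>X\<close> lets sums and series pass through.\<close>

definition cact :: "real ^ 'n ^ 'n \<Rightarrow> complex ^ 'n \<Rightarrow> complex ^ 'n" where
  "cact X v = map_matrix complex_of_real X *v v"

lemma cact_component: "cact X v $ i = (\<Sum>j\<in>UNIV. X $ i $ j *\<^sub>R v $ j)"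
  by (simp add: cact_def matrix_vector_mult_def scaleR_conv_of_real)

lemma matrix_spectrum_iff: "z \<in> matrix_spectrum X \<longleftrightarrow> (\<exists>v. v \<noteq> 0 \<and> cact X v = z *s v)"
  by (simp add: matrix_spectrum_def cact_def)

lemma cact_mult: "cact (X ** Y) v = cact X (cact Y v)"
proof -
  have "map_matrix complex_of_real (X ** Y) = map_matrix of_real X ** map_matrix of_real Y"
    by (simp add: vec_eq_iff matrix_matrix_mult_def)
  then show ?thesis
    by (simp add: cact_def matrix_vector_mul_assoc)
qed

lemma cact_one [simp]:
  fixes v :: "complex ^ 'n"
  shows "cact (mat 1) v = v"
proof -
  have "map_matrix complex_of_real (mat 1 :: real ^ 'n ^ 'n) = mat 1"
    by (simp add: vec_eq_iff mat_def)
  then show ?thesis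
    by (simp add: cact_def)
qed

lemma bounded_linear_cact_left: "bounded_linear (\<lambda>X. cact X v)"
  by (rule linear_conv_bounded_linear[THEN iffD1], rule linearI)
    (simp_all add: vec_eq_iff cact_component scaleR_add_left sum.distrib scaleR_sum_right)

lemmas cact_left_simps =
  linear_add[OF bounded_linear.linear[OF bounded_linear_cact_left]]
  linear_diff[OF bounded_linear.linear[OF bounded_linear_cact_left]]
  linear_sum[OF bounded_linear.linear[OF bounded_linear_cact_left]]
  linear_cmul[OF bounded_linear.linear[OF bounded_linear_cact_left]]

lemma cact_zero_left [simp]: "cact 0 v = 0"
  by (simp add: vec_eq_iff cact_component)

lemma cact_zero_right [simp]: "cact X 0 = 0"
  by (simp add: cact_def)

lemma cact_add_right: "cact X (v + w) = cact X v + cact X w"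
  by (simp add: cact_def matrix_vector_right_distrib)

lemma cact_diff_right: "cact X (v - w) = cact X v - cact X w"
  by (simp add: cact_def matrix_vector_mult_diff_distrib)

lemma cact_scale_right: "cact X (z *s v) = z *s cact X v"
  by (simp add: cact_def vector_scalar_commute)

lemma cact_matrix_power:
  assumes "cact X w = z *s w"
  shows "cact (matrix_power X m) w = z ^ m *s w"
  by (induct m) (simp_all add: cact_mult cact_scale_right assms)

lemma bounded_linear_scale_vector: "bounded_linear (\<lambda>z. z *s (w :: complex ^ 'n))"
  by (rule linear_conv_bounded_linear[THEN iffD1], rule linearI)
    (simp_all add: vec_eq_iff algebra_simps)

lemma scaleR_scale_vector: "(r *\<^sub>R z) *s w = r *\<^sub>R (z *s w)" for w :: "complex ^ 'n"
  by (rule linear_cmul[OF bounded_linear.linear[OF bounded_linear_scale_vector]])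

lemma cact_sum_matrix_power:
  assumes "cact A w = z *s w"
  shows "cact (\<Sum>i\<in>I. f i *\<^sub>R matrix_power A (e i)) w = (\<Sum>i\<in>I. f i *\<^sub>R z ^ e i) *s w"
proof -
  have "(\<Sum>i\<in>I. f i *\<^sub>R z ^ e i) *s w = (\<Sum>i\<in>I. (f i *\<^sub>R z ^ e i) *s w)"
    by (rule linear_sum[OF bounded_linear.linear[OF bounded_linear_scale_vector]])
  also have "\<dots> = (\<Sum>i\<in>I. f i *\<^sub>R (z ^ e i *s w))"
    by (simp add: scaleR_scale_vector)
  finally show ?thesis
    by (simp add: cact_left_simps cact_matrix_power[OF assms])
qed

section \<open>The matrix exponential on complex vectors\<close>

lemma cact_matrix_exp_sums:
  "(\<lambda>m. cact ((1 / fact m) *\<^sub>R matrix_power X m) v) sums cact (matrix_exp X) v"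
proof -
  have "(\<lambda>m. (1 / fact m) *\<^sub>R matrix_power X m) sums matrix_exp X"
    using matrix_exp_sums[of "of_mat X"] matrix_exp_to_mat[of "of_mat X"]
    by (simp add: of_mat_inverse)
  then show ?thesis
    by (rule bounded_linear.sums[OF bounded_linear_cact_left])
qed

lemma cact_matrix_exp:
  assumes "cact X w = z *s w"
  shows "cact (matrix_exp X) w = exp z *s w"
proof -
  have "(\<lambda>m. (z ^ m /\<^sub>R fact m) *s w) sums (exp z *s w)"
    by (rule bounded_linear.sums[OF bounded_linear_scale_vector exp_converges])
  moreover have "(z ^ m /\<^sub>R fact m) *s w = cact ((1 / fact m) *\<^sub>R matrix_power X m) w" for m
    by (simp add: cact_left_simps cact_matrix_power[OF assms] inverse_eq_divide
        scaleR_scale_vector)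
  ultimately have "(\<lambda>m. cact ((1 / fact m) *\<^sub>R matrix_power X m) w) sums (exp z *s w)"
    by simp
  then show ?thesis
    by (rule sums_unique2[OF cact_matrix_exp_sums])
qed

lemma cact_matrix_exp_square_zero:
  assumes "cact X (cact X u) = 0"
  shows "cact (matrix_exp X) u = u + cact X u"
proof -
  \<comment> \<open>One factor is applied to \<open>u\<close> first: \<open>cact X u\<close>
    satisfies the eigenvector equation for 0, so every further positive power kills it.\<close>
  have "cact (matrix_power X (Suc m)) u = cact (matrix_power X m) (cact X u)" for m
    by (induct m) (simp_all add: cact_mult)
  then have "cact (matrix_power X (Suc (Suc m))) u = 0" for m
    using cact_matrix_power[of X "cact X u" 0 "Suc m"] assms by (simp del: matrix_power.simps)
  then have "cact ((1 / fact m) *\<^sub>R matrix_power X m) u = 0" if "m \<notin> {0, 1}" for m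
    using that less_imp_Suc_add[of 1 m] by (auto simp: cact_left_simps)
  then have "(\<lambda>m. cact ((1 / fact m) *\<^sub>R matrix_power X m) u) sums
      (\<Sum>m\<in>{0, 1}. cact ((1 / fact m) *\<^sub>R matrix_power X m) u)"
    by (intro sums_finite) auto
  then have "(\<lambda>m. cact ((1 / fact m) *\<^sub>R matrix_power X m) u) sums (u + cact X u)"
    by simp
  then show ?thesis
    by (rule sums_unique2[OF cact_matrix_exp_sums])
qed

lemma complex_eigenvector_in_subspace:
  assumes "vec.subspace V" "\<And>w. w \<in> V \<Longrightarrow> cact X w \<in> V" "v \<in> V" "v \<noteq> 0"
  obtains w z where "w \<in> V" "w \<noteq> 0" "cact X w = z *s w"
  using invariant_subspace_eigenvector[of V "map_matrix complex_of_real X" v] assms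
  unfolding cact_def by metis

lemma subspace_cact_range: "vec.subspace (range (cact X))"
  unfolding vec.subspace_def
  by (auto simp flip: cact_add_right cact_scale_right) (metis cact_zero_right rangeI)

lemma subspace_cact_eigenspace: "vec.subspace {v. cact X v = z *s v}"
  unfolding vec.subspace_def
  by (auto simp: cact_add_right cact_scale_right vec.scale_right_distrib mult.commute)

section \<open>Uniqueness among commuting logarithms\<close>

lemma matrix_exp_diff_commuting:
  assumes "X ** Y = Y ** X" "matrix_exp X = matrix_exp Y"
  shows "matrix_exp (Y - X) = mat 1"
proof -
  let ?x = "of_mat X" and ?y = "of_mat Y"
  have "?x * ?y = ?y * ?x"
    using assms(1) by (simp add: times_mat_alg_def of_mat_inverse)
  then have "exp (?y + - ?x) = exp ?y * exp (- ?x)"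
    by (intro exp_add_commuting) simp
  moreover have "exp ?x = exp ?y"
    using assms(2) matrix_exp_to_mat[of ?x] matrix_exp_to_mat[of ?y]
    by (simp add: of_mat_inverse to_mat_inject)
  ultimately have "exp (?y - ?x) = 1"
    by (metis diff_conv_add_uminus exp_minus_inverse)
  then show ?thesis
    using matrix_exp_to_mat[of "?y - ?x"]
    by (simp add: of_mat_inverse minus_mat_alg.rep_eq one_mat_alg.rep_eq)
qed

text \<open>Equal eigenvalues alone would leave a nilpotent difference possible. The common
  eigenvector is therefore sought inside the range of Y - X, where e^(Y-X) = I rules it out.\<close>

lemma matrix_exp_inj_commuting:
  assumes comm: "X ** Y = Y ** X" and eq: "matrix_exp X = matrix_exp Y"
    and X: "\<And>z. z \<in> matrix_spectrum X \<Longrightarrow> - pi < Im z \<and> Im z < pi"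
    and Y: "\<And>z. z \<in> matrix_spectrum Y \<Longrightarrow> - pi < Im z \<and> Im z < pi"
  shows "X = Y"
proof (rule ccontr)
  assume "X \<noteq> Y"
  define Z where "Z = Y - X"
  have XY: "cact X (cact Y v) = cact Y (cact X v)" for v
    using comm by (metis cact_mult)
  have XZ: "cact X (cact Z v) = cact Z (cact X v)" and YZ: "cact Y (cact Z v) = cact Z (cact Y v)" for v
    by (simp_all add: Z_def cact_left_simps(2) cact_diff_right XY)
  from \<open>X \<noteq> Y\<close> have "Z \<noteq> 0"
    by (simp add: Z_def)
  then obtain i j where "Z $ i $ j \<noteq> 0"
    by (auto simp: vec_eq_iff)
  \<comment> \<open>The axis vector selects column j of Z, so the range of Z contains a nonzero
    vector.\<close>
  then have "cact Z (axis j 1) $ i \<noteq> 0"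
    by (simp add: cact_component axis_def if_distrib cong: if_cong)
  then have "cact Z (axis j 1) \<noteq> 0"
    by (metis zero_index)
  moreover have "cact X w \<in> range (cact Z)" if "w \<in> range (cact Z)" for w
    using that XZ by auto
  ultimately obtain v x where v: "v \<in> range (cact Z)" "v \<noteq> 0" "cact X v = x *s v"
    using complex_eigenvector_in_subspace[OF subspace_cact_range[of Z]] by (metis rangeI)
  \<comment> \<open>Y commutes with both Z and X, so it preserves this part of an eigenspace of X;
    an eigenvector of Y in it is common to both.\<close>
  let ?V = "range (cact Z) \<inter> {v. cact X v = x *s v}"
  have "vec.subspace ?V"
    by (intro vec.subspace_inter subspace_cact_range subspace_cact_eigenspace)
  moreover have "cact Y w \<in> ?V" if "w \<in> ?V" for w
    using that YZ XY by (auto simp: cact_scale_right)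
  ultimately obtain w y where w: "w \<in> ?V" "w \<noteq> 0" "cact Y w = y *s w"
    using v complex_eigenvector_in_subspace[of ?V Y v] by auto
  then obtain u where u: "w = cact Z u" "cact X w = x *s w"
    by auto
  have "exp x = exp y"
    using cact_matrix_exp[OF u(2)] cact_matrix_exp[OF w(3)] eq w(2) by simp
  moreover have "- pi < Im x" "Im x < pi" "- pi < Im y" "Im y < pi"
    using X Y w u by (auto simp: matrix_spectrum_iff)
  \<comment> \<open>In the strip each of \<open>x\<close> and \<open>y\<close> is the principal
    logarithm of its exponential.\<close>
  ultimately have "x = y"
    by (metis Ln_exp less_imp_le)
  then have "cact Z (cact Z u) = 0"
    using w u by (simp add: Z_def cact_left_simps)
  then have "cact (matrix_exp Z) u = u + w"
    by (simp add: cact_matrix_exp_square_zero u)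
  then show False
    using matrix_exp_diff_commuting[OF comm eq] w(2) by (simp add: Z_def)
qed

section \<open>The domain of the logarithm and the roots of p\<close>

lemma cact_one_minus:
  assumes "cact A w = z *s w"
  shows "cact (mat 1 - t *\<^sub>R A) w = (1 - t *\<^sub>R z) *s w"
  using assms by (simp add: cact_left_simps vec.scale_left_diff_distrib
      scaleR_scale_vector)

text \<open>A real eigenvalue x of A gives the eigenvalue 1 - xt of I - tA, which is nonpositive
  exactly when xt is at least 1. Half-spaces make convexity immediate, and openness once there are
  finitely many.\<close>

lemma log_domain_eq:
  "log_domain A = (\<Inter>x\<in>{x. complex_of_real x \<in> matrix_spectrum A}. {t. inner x t < 1})"
proof (intro set_eqI iffI)
  fix t
  assume t: "t \<in> log_domain A"
  have "x * t < 1" if x: "complex_of_real x \<in> matrix_spectrum A" for x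
  proof (rule ccontr)
    assume *: "\<not> x * t < 1"
    obtain v where "v \<noteq> 0" "cact A v = complex_of_real x *s v"
      using x by (auto simp: matrix_spectrum_iff)
    then have "1 - t *\<^sub>R complex_of_real x \<in> matrix_spectrum (mat 1 - t *\<^sub>R A)"
      using cact_one_minus matrix_spectrum_iff by blast
    moreover have "1 - t *\<^sub>R complex_of_real x = complex_of_real (1 - x * t)"
      by (simp add: scaleR_conv_of_real)
    moreover have "complex_of_real (1 - x * t) \<in> complex_of_real ` {..0}"
      using * by (intro imageI) simp
    ultimately show False
      using t unfolding log_domain_def by (metis (mono_tags) disjoint_iff mem_Collect_eq)
  qed
  then show "t \<in> (\<Inter>x\<in>{x. complex_of_real x \<in> matrix_spectrum A}. {t. inner x t < 1})"
    by simp
next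
  fix t
  assume t: "t \<in> (\<Inter>x\<in>{x. complex_of_real x \<in> matrix_spectrum A}. {t. inner x t < 1})"
  show "t \<in> log_domain A"
  proof (rule ccontr)
    assume "t \<notin> log_domain A"
    then obtain x v where xv: "x \<le> 0" "v \<noteq> 0" "cact (mat 1 - t *\<^sub>R A) v = complex_of_real x *s v"
      by (auto simp: log_domain_def matrix_spectrum_iff)
    then have tA: "t *\<^sub>R cact A v = complex_of_real (1 - x) *s v"
      by (simp add: cact_left_simps algebra_simps vec.scale_left_diff_distrib)
    \<comment> \<open>For t = 0 the left side of \<open>tA\<close> vanishes, whereas 1 - x is at
      least 1.\<close>
    have "t \<noteq> 0"
    proof
      assume "t = 0"
      then have "complex_of_real (1 - x) *s v = 0"
        using tA by (metis scaleR_zero_left)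
      then have "complex_of_real (1 - x) = 0"
        using xv(2) vec.scale_eq_0_iff by blast
      with xv(1) show False
        by (simp only: of_real_eq_0_iff)
    qed
    then have "cact A v = (1 / t) *\<^sub>R (t *\<^sub>R cact A v)"
      by simp
    also note tA
    also have "(1 / t) *\<^sub>R (complex_of_real (1 - x) *s v) = ((1 / t) *\<^sub>R complex_of_real (1 - x)) *s v"
      by (simp only: scaleR_scale_vector)
    also have "(1 / t) *\<^sub>R complex_of_real (1 - x) = complex_of_real ((1 - x) / t)"
      by (simp add: scaleR_conv_of_real)
    finally have "cact A v = complex_of_real ((1 - x) / t) *s v" .
    then have "complex_of_real ((1 - x) / t) \<in> matrix_spectrum A"
      using xv matrix_spectrum_iff by blast
    then have "inner ((1 - x) / t) t < 1"
      using t by blast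
    then show False
      using \<open>t \<noteq> 0\<close> xv by simp
  qed
qed

text \<open>Applying p(A) to an eigenvector multiplies it by p(z). This supplies the scalar relation
  under which the differential equation holds in the complex numbers.\<close>

lemma eigenvalue_root:
  assumes "monic_eval_matrix c k A = 0" "z \<in> matrix_spectrum A"
  shows "z ^ k + (\<Sum>m = 1..k. c m *\<^sub>R z ^ (k - m)) = 0"
proof -
  obtain w where w: "w \<noteq> 0" "cact A w = z *s w"
    using assms(2) by (auto simp: matrix_spectrum_iff)
  have "(z ^ k + (\<Sum>m = 1..k. c m *\<^sub>R z ^ (k - m))) *s w = cact (monic_eval_matrix c k A) w"
    by (simp add: monic_eval_matrix_def cact_left_simps(1) cact_sum_matrix_power[OF w(2)]
        cact_matrix_power[OF w(2)] vec.scale_left_distrib)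
  then show ?thesis
    using assms(1) w(1) by (metis cact_zero_left vec.scale_eq_0_iff)
qed

lemma monic_eval_of_real:
  "complex_of_real (monic_eval c k x) = of_real x ^ k + (\<Sum>m = 1..k. c m *\<^sub>R of_real x ^ (k - m))"
  by (simp add: monic_eval_def scaleR_conv_of_real)

text \<open>Bounds the number of real eigenvalues of A, so that \<open>log_domain\<close> is a
  finite intersection of open sets.\<close>

lemma finite_monic_roots: "finite {x. monic_eval c k x = 0}"
proof -
  let ?p = "monom 1 k + (\<Sum>m = 1..k. monom (c m) (k - m))"
  have "(\<Sum>m = 1..k. coeff (monom (c m) (k - m)) k) = 0"
    by (intro sum.neutral) auto
  then have "coeff ?p k = 1"
    by (simp add: coeff_sum)
  then have "?p \<noteq> 0"
    by (metis coeff_0 zero_neq_one)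
  moreover have "poly ?p x = monic_eval c k x" for x
    by (simp add: monic_eval_def poly_monom poly_sum)
  ultimately show ?thesis
    using poly_roots_finite[of ?p] by simp
qed

lemma log_domain_open_interval:
  assumes "monic_eval_matrix c k A = 0"
  shows "open (log_domain A)" "is_interval (log_domain A)"
proof -
  have "monic_eval c k x = 0" if "complex_of_real x \<in> matrix_spectrum A" for x
    using eigenvalue_root[OF assms that] monic_eval_of_real of_real_eq_0_iff by metis
  then have "finite {x. complex_of_real x \<in> matrix_spectrum A}"
    by (blast intro: finite_subset[OF _ finite_monic_roots[of c k]])
  then show "open (log_domain A)"
    unfolding log_domain_eq by (intro open_INT ballI open_halfspace_lt)
  show "is_interval (log_domain A)"
    unfolding is_interval_convex_1 log_domain_eq by (intro convex_INT convex_halfspace_lt)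
qed

lemma zero_in_log_domain: "0 \<in> log_domain A"
  by (simp add: log_domain_eq)

section \<open>The sum is the principal logarithm\<close>

lemma principal_log_eq_sum:
  assumes k: "k \<ge> 2" and A: "monic_eval_matrix c k A = 0" and t: "t \<in> log_domain A"
    and denom: "\<And>s. s \<in> closed_segment 0 t \<Longrightarrow> log_denom c k s \<noteq> 0"
  shows "principal_log (mat 1 - t *\<^sub>R A) = (\<Sum>i = 1..k. log_coeff c k i t *\<^sub>R matrix_power A (i - 1))"
proof -
  define X where "X = (\<Sum>i = 1..k. log_coeff c k i t *\<^sub>R matrix_power A (i - 1))"
  define a where "a = of_mat A"
  define x where "x = (\<Sum>i = 1..k. log_coeff c k i t *\<^sub>R a ^ (i - 1))"
  have to_mat_lin: "to_mat (r *\<^sub>R M) = r *\<^sub>R to_mat M" "to_mat (M + N) = to_mat M + to_mat N"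
    "to_mat (M - N) = to_mat M - to_mat N"
    "to_mat (M * N) = to_mat M ** to_mat N" "to_mat 0 = 0" "to_mat 1 = mat 1" for r and M N :: "'a mat_alg"
    by (transfer; simp)+
  have to_mat_sum: "to_mat (\<Sum>i\<in>I. f i) = (\<Sum>i\<in>I. to_mat (f i))" for f :: "nat \<Rightarrow> 'a mat_alg" and I
    by (rule linear_sum[OF bounded_linear.linear[OF bounded_linear_to_mat]])
  have a: "to_mat a = A"
    by (simp add: a_def of_mat_inverse)
  have xX: "to_mat x = X"
    by (simp add: x_def X_def to_mat_lin to_mat_sum to_mat_power a)
  have "to_mat (a ^ k + (\<Sum>m = 1..k. c m *\<^sub>R a ^ (k - m))) = to_mat 0"
    using A by (simp add: monic_eval_matrix_def to_mat_lin to_mat_sum to_mat_power a)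
  then have root: "a ^ k + (\<Sum>m = 1..k. c m *\<^sub>R a ^ (k - m)) = 0"
    by (simp only: to_mat_inject)
  have expx: "exp x = 1 - t *\<^sub>R a"
    unfolding x_def by (rule exp_log_sum[OF k root denom])
  have expX: "matrix_exp X = mat 1 - t *\<^sub>R A"
    using matrix_exp_to_mat[of x] by (simp add: expx xX to_mat_lin a)
  have strip: "- pi < Im z \<and> Im z < pi" if "z \<in> matrix_spectrum X" for z
  proof -
    obtain v where v: "v \<noteq> 0" "cact X v = z *s v"
      using \<open>z \<in> matrix_spectrum X\<close> by (auto simp: matrix_spectrum_iff)
    have "a * x = x * a"
      by (simp add: x_def sum_distrib_left sum_distrib_right power_commutes)
    then have "A ** X = X ** A"
      by (metis to_mat_lin(4) a xX)
    then have "cact X (cact A u) = cact A (cact X u)" for u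
      by (metis cact_mult)
    \<comment> \<open>A commutes with X and so preserves the eigenspace of X for \<open>z\<close>;
      an eigenvector of A in it expresses \<open>z\<close> through an eigenvalue of A.\<close>
    then obtain w y where w: "cact X w = z *s w" "w \<noteq> 0" "cact A w = y *s w"
      using complex_eigenvector_in_subspace[OF subspace_cact_eigenspace[of X z], of A v] v
      by (auto simp: cact_scale_right)
    have y: "y \<in> matrix_spectrum A"
      using w by (auto simp: matrix_spectrum_iff)
    have slit: "1 - s *\<^sub>R y \<notin> \<real>\<^sub>\<le>\<^sub>0" if s: "s \<in> closed_segment 0 t" for s
    proof
      assume "1 - s *\<^sub>R y \<in> \<real>\<^sub>\<le>\<^sub>0"
      then have "1 - s *\<^sub>R y \<in> complex_of_real ` {..0}"
        by (auto elim!: nonpos_Reals_cases)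
      moreover have "1 - s *\<^sub>R y \<in> matrix_spectrum (mat 1 - s *\<^sub>R A)"
        using cact_one_minus[OF w(3)] w(2) by (auto simp: matrix_spectrum_iff)
      ultimately have "s \<notin> log_domain A"
        by (auto simp: log_domain_def)
      \<comment> \<open>The domain is an interval containing 0, so the whole path from 0 to t avoids
        the slit, not only its end.\<close>
      moreover have "closed_segment 0 t \<subseteq> log_domain A"
        using log_domain_open_interval(2)[OF A] zero_in_log_domain t
        by (intro closed_segment_subset) (simp_all add: is_interval_convex_1)
      ultimately show False
        using s by blast
    qed
    have "z *s w = (\<Sum>i = 1..k. log_coeff c k i t *\<^sub>R y ^ (i - 1)) *s w"
      using cact_sum_matrix_power[OF w(3), of "\<lambda>i. log_coeff c k i t" "\<lambda>i. i - 1" "{1..k}"] w(1)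
      by (simp only: X_def)
    then have "z = (\<Sum>i = 1..k. log_coeff c k i t *\<^sub>R y ^ (i - 1))"
      using w(2) by simp
    then have z: "z = Ln (1 - t *\<^sub>R y)"
      using log_sum_eq_Ln[OF k eigenvalue_root[OF A y] denom slit] by simp
    have "1 - t *\<^sub>R y \<notin> \<real>\<^sub>\<le>\<^sub>0"
      by (rule slit) simp
    then show ?thesis
      unfolding z by (metis Im_Ln_less_pi mpi_less_Im_Ln nonpos_Reals_zero_I)
  qed
  have "Y = X" if Y: "matrix_exp Y = mat 1 - t *\<^sub>R A"
    "\<forall>z\<in>matrix_spectrum Y. - pi < Im z \<and> Im z < pi" for Y
  proof (rule matrix_exp_inj_commuting)
    define y where "y = of_mat Y"
    have yY: "to_mat y = Y"
      by (simp add: y_def of_mat_inverse)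
    have "to_mat (exp y) = to_mat (exp x)"
      using matrix_exp_to_mat[of x] matrix_exp_to_mat[of y] Y(1) expX by (simp add: xX yY)
    then have expy: "exp y = 1 - t *\<^sub>R a"
      using expx by (simp add: to_mat_inject)
    \<comment> \<open>Y commutes with its own exponential I - tA.\<close>
    have ya: "t *\<^sub>R (y * a) = t *\<^sub>R (a * y)"
      using exp_times_arg_commute[of y] unfolding expy by (simp add: algebra_simps)
    have "y * x = x * y"
    \<comment> \<open>For t = 0 the relation \<open>ya\<close> says nothing, but then all
      coefficients vanish and \<open>x\<close> is 0.\<close>
    proof (cases "t = 0")
      case True
      then show ?thesis
        by (simp add: x_def log_coeff_0)
    next
      case False
      then have "y * a ^ i = a ^ i * y" for i
        using ya power_commuting_commutes[of a y i] by simp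
      then show ?thesis
        by (simp add: x_def sum_distrib_left sum_distrib_right)
    qed
    then show "Y ** X = X ** Y"
      by (metis to_mat_lin(4) xX yY)
  qed (use Y expX strip in auto)
  then show ?thesis
    unfolding principal_log_def X_def[symmetric]
    using expX strip by (intro the_equality) blast+
qed

text \<open>The denominator is the reversed polynomial of p: its zeros are the reciprocals of the
  nonzero roots of p.\<close>

lemma log_denom_conv_monic_eval:
  assumes "t \<noteq> 0"
  shows "log_denom c k t = t ^ k * monic_eval c k (1 / t)"
proof -
  have "t ^ k * (1 / t) ^ (k - m) = t ^ m" if "m \<le> k" for m
    using that assms by (simp add: power_diff power_one_over field_simps)
  from this[of 0] this show ?thesis
    by (simp add: log_denom_def monic_eval_def distrib_left sum_distrib_left mult.left_commute)
qed

text \<open>A real root of p that is not an eigenvalue of A can put a pole inside the domain: for A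
  = 0 and p(x) = x (x - 1) the domain is the whole line, but the denominator is 1 - s. Hence the
  condition on the segment. By the last part it holds on the whole domain if every nonzero real root
  of p is an eigenvalue of A, since the domain is an interval containing 0.\<close>

theorem corollary2p2:
  fixes A :: "real ^ 'n ^ 'n" and c :: "nat \<Rightarrow> real" and k :: nat
  assumes "k \<ge> 2"
    and "monic_eval_matrix c k A = 0"
  shows "open (log_domain A) \<and> is_interval (log_domain A) \<and> 0 \<in> log_domain A \<and>
    (\<forall>t \<in> log_domain A. (\<forall>s \<in> closed_segment 0 t. log_denom c k s \<noteq> 0) \<longrightarrow>
       (\<forall>i \<in> {1..k}. log_coeff c k i differentiable (at t)) \<and>
       principal_log (mat 1 - t *\<^sub>R A) =
         (\<Sum>i = 1..k. log_coeff c k i t *\<^sub>R matrix_power A (i - 1))) \<and>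
    ((\<forall>x. x \<noteq> 0 \<and> monic_eval c k x = 0 \<longrightarrow> complex_of_real x \<in> matrix_spectrum A) \<longrightarrow>
       (\<forall>t \<in> log_domain A. log_denom c k t \<noteq> 0))"
proof (intro conjI ballI impI)
  show "open (log_domain A)" "is_interval (log_domain A)" "0 \<in> log_domain A"
    using log_domain_open_interval[OF assms(2)] zero_in_log_domain by auto
next
  fix t i
  assume "\<forall>s \<in> closed_segment 0 t. log_denom c k s \<noteq> 0"
  then obtain a b where "a < min 0 t" "max 0 t < b" "\<And>s. s \<in> {a..b} \<Longrightarrow> log_denom c k s \<noteq> 0"
    using log_denom_nonzero_interval[of t c k] by metis
  then have "(log_coeff c k i has_vector_derivative log_numer c k i t / log_denom c k t) (at t)"
    by (intro log_coeff_has_vector_derivative[of a b]) auto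
  then show "log_coeff c k i differentiable (at t)"
    by (rule differentiableI_vector)
next
  fix t
  assume "t \<in> log_domain A" "\<forall>s \<in> closed_segment 0 t. log_denom c k s \<noteq> 0"
  then show "principal_log (mat 1 - t *\<^sub>R A) = (\<Sum>i = 1..k. log_coeff c k i t *\<^sub>R matrix_power A (i - 1))"
    using principal_log_eq_sum[OF assms] by blast
next
  fix t
  assume roots: "\<forall>x. x \<noteq> 0 \<and> monic_eval c k x = 0 \<longrightarrow> complex_of_real x \<in> matrix_spectrum A"
    and t: "t \<in> log_domain A"
  show "log_denom c k t \<noteq> 0"
  proof
    assume zero: "log_denom c k t = 0"
    then have "t \<noteq> 0"
      by (auto simp: log_denom_def)
    \<comment> \<open>A zero t of the denominator makes 1/t a root of p, hence an eigenvalue; but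
      (1/t) t = 1 is excluded on the domain.\<close>
    then have "complex_of_real (1 / t) \<in> matrix_spectrum A"
      using zero roots by (intro roots[rule_format]) (simp add: log_denom_conv_monic_eval)
    then have "inner (1 / t) t < 1"
      using t unfolding log_domain_eq by blast
    with \<open>t \<noteq> 0\<close> show False by simp
  qed
qed

end
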